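(* Let $G$ be a group, let $R$ be a $G$-graded ring with unity, and let $I$ be a graded right ideal of $R$ with $(I^{2}:I)\subseteq I$. Then $I$ is a graded prime right ideal of $R$ if and only if $I$ is a graded almost prime right ideal of $R$.
   Context: Rings are associative and not assumed commutative; here $R$ has unity. A ring $R$ is $G$-graded if $R=\bigoplus_{g\in G}R_g$ with $R_g$ additive subgroups and $R_gR_h\subseteq R_{gh}$ for all $g,h\in G$; $x_g$ denotes the component of $x\in R$ in $R_g$. A right ideal $P$ is graded if $P=\bigoplus_{g\in G}(P\cap R_g)$, i.e. $x\in P$ implies $x_g\in P$ for all $g\in G$. The product $XY$ of right ideals is the set of finite sums of products $xy$ with $x\in X$, $y\in Y$, and $P^2=PP$. For subsets $P,K\subseteq R$, $(P:K)=\{x\in R: Kx\subseteq P\}$. A proper graded right ideal $P$ of $R$ is graded prime if, for all graded right ideals $X,Y$ of $R$, $XY\subseteq P$ implies $X\subseteq P$ or $Y\subseteq P$. It is graded almost prime if, for all graded right ideals $X,Y$ of $R$, $XY\subseteq P$ and $XY\nsubseteq P^2$ imply $X\subseteq P$ or $Y\subseteq P$. *)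

theory Defs
  imports "HOL-Algebra.Ideal_Product"
begin

text \<open>A family \<open>A\<close> of homogeneous parts is indexed by the carrier of \<open>G\<close>.  A decomposition of \<open>x\<close>
  is a finitely supported choice of elements \<open>f g \<in> A g\<close> with sum \<open>x\<close>; membership in the extensional
  function space makes values outside the carrier of \<open>G\<close> irrelevant for uniqueness.\<close>

definition homogeneous_decomposition ::
  "('g, 'n) monoid_scheme \<Rightarrow> ('a, 'm) ring_scheme \<Rightarrow> ('g \<Rightarrow> 'a set) \<Rightarrow> 'a \<Rightarrow> ('g \<Rightarrow> 'a) \<Rightarrow> bool" where
  "homogeneous_decomposition G R A x f \<longleftrightarrow>
     f \<in> (\<Pi>\<^sub>E g\<in>carrier G. A g) \<and>
     finite {g \<in> carrier G. f g \<noteq> \<zero>\<^bsub>R\<^esub>} \<and>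
     x = finsum R f {g \<in> carrier G. f g \<noteq> \<zero>\<^bsub>R\<^esub>}"

text \<open>The uniqueness assumption \<open>direct_sum\<close> expresses that \<open>R\<close> is the internal direct sum of the
  additive subgroups \<open>A g\<close>.\<close>

locale graded_ring = group G + ring R
  for G (structure) and R (structure) and A +
  assumes homogeneous_subgroup: "g \<in> carrier G \<Longrightarrow> additive_subgroup (A g) R"
    and direct_sum: "x \<in> carrier R \<Longrightarrow> \<exists>!f. homogeneous_decomposition G R A x f"
    and homogeneous_mult:
      "\<lbrakk> g \<in> carrier G; h \<in> carrier G; x \<in> A g; y \<in> A h \<rbrakk> \<Longrightarrow> x \<otimes>\<^bsub>R\<^esub> y \<in> A (g \<otimes>\<^bsub>G\<^esub> h)"

text \<open>Meaningful only for \<open>x \<in> carrier R\<close> and \<open>g \<in> carrier G\<close>.\<close>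

definition homogeneous_component ::
  "('g, 'n) monoid_scheme \<Rightarrow> ('a, 'm) ring_scheme \<Rightarrow> ('g \<Rightarrow> 'a set) \<Rightarrow> 'a \<Rightarrow> 'g \<Rightarrow> 'a" where
  "homogeneous_component G R A x = (THE f. homogeneous_decomposition G R A x f)"

locale right_ideal = additive_subgroup I R + ring R for I and R (structure) +
  assumes I_r_closed: "\<lbrakk> a \<in> I; x \<in> carrier R \<rbrakk> \<Longrightarrow> a \<otimes> x \<in> I"

definition graded_right_ideal ::
  "('g, 'n) monoid_scheme \<Rightarrow> ('a, 'm) ring_scheme \<Rightarrow> ('g \<Rightarrow> 'a set) \<Rightarrow> 'a set \<Rightarrow> bool" where
  "graded_right_ideal G R A P \<longleftrightarrow>
     right_ideal P R \<and>
     (\<forall>x\<in>P. \<forall>g\<in>carrier G. homogeneous_component G R A x g \<in> P)"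

definition colon :: "('a, 'm) ring_scheme \<Rightarrow> 'a set \<Rightarrow> 'a set \<Rightarrow> 'a set" where
  "colon R P K = {x \<in> carrier R. \<forall>k\<in>K. k \<otimes>\<^bsub>R\<^esub> x \<in> P}"

text \<open>\<open>ideal_prod R X Y\<close> is the closure of the products \<open>x \<otimes> y\<close> under addition, that is, the set of
  their nonempty finite sums.  Right ideals contain zero, so the empty sum is included as well.\<close>

definition graded_prime_right_ideal ::
  "('g, 'n) monoid_scheme \<Rightarrow> ('a, 'm) ring_scheme \<Rightarrow> ('g \<Rightarrow> 'a set) \<Rightarrow> 'a set \<Rightarrow> bool" where
  "graded_prime_right_ideal G R A P \<longleftrightarrow>
     graded_right_ideal G R A P \<and> P \<noteq> carrier R \<and>
     (\<forall>X Y. graded_right_ideal G R A X \<longrightarrow> graded_right_ideal G R A Y \<longrightarrow>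
        ideal_prod R X Y \<subseteq> P \<longrightarrow> X \<subseteq> P \<or> Y \<subseteq> P)"

definition graded_almost_prime_right_ideal ::
  "('g, 'n) monoid_scheme \<Rightarrow> ('a, 'm) ring_scheme \<Rightarrow> ('g \<Rightarrow> 'a set) \<Rightarrow> 'a set \<Rightarrow> bool" where
  "graded_almost_prime_right_ideal G R A P \<longleftrightarrow>
     graded_right_ideal G R A P \<and> P \<noteq> carrier R \<and>
     (\<forall>X Y. graded_right_ideal G R A X \<longrightarrow> graded_right_ideal G R A Y \<longrightarrow>
        ideal_prod R X Y \<subseteq> P \<longrightarrow> \<not> ideal_prod R X Y \<subseteq> ideal_prod R P P \<longrightarrow>
        X \<subseteq> P \<or> Y \<subseteq> P)"

end

theory Submission
  imports Defs
begin

text \<open>Only the implication from almost prime to prime has content.  Let \<open>X Y \<subseteq> I\<close>.  The idea is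
  to apply almost primeness not to \<open>X\<close> but to the larger graded right ideal \<open>X + I\<close>: since \<open>I\<close>
  absorbs multiplication from the right, \<open>(X + I) Y\<close> is still contained in \<open>I\<close>.  If \<open>(X + I) Y\<close> is
  not inside \<open>I\<^sup>2\<close>, almost primeness gives \<open>X + I \<subseteq> I\<close>, hence \<open>X \<subseteq> I\<close>, or \<open>Y \<subseteq> I\<close>.  If it is
  inside \<open>I\<^sup>2\<close>, then so is \<open>I Y\<close>, that is, \<open>Y \<subseteq> (I\<^sup>2 : I) \<subseteq> I\<close>.  That \<open>X + I\<close> is again graded
  comes down to the additivity of homogeneous components, which follows from the uniqueness of
  homogeneous decompositions.\<close>

lemma homogeneous_decomposition_add:
  assumes "graded_ring G R A"
    and "homogeneous_decomposition G R A x f" and "homogeneous_decomposition G R A y h"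
  shows "homogeneous_decomposition G R A (x \<oplus>\<^bsub>R\<^esub> y) (\<lambda>g\<in>carrier G. f g \<oplus>\<^bsub>R\<^esub> h g)"
proof -
  interpret graded_ring G R A by fact
  let ?k = "\<lambda>g\<in>carrier G. f g \<oplus>\<^bsub>R\<^esub> h g"
  let ?F = "{g \<in> carrier G. f g \<noteq> \<zero>\<^bsub>R\<^esub>}"
  let ?H = "{g \<in> carrier G. h g \<noteq> \<zero>\<^bsub>R\<^esub>}"
  let ?K = "{g \<in> carrier G. ?k g \<noteq> \<zero>\<^bsub>R\<^esub>}"
  have f: "f g \<in> A g" and h: "h g \<in> A g" if "g \<in> carrier G" for g
    using assms(2,3) that by (auto simp: homogeneous_decomposition_def PiE_iff)
  have fc: "f g \<in> carrier R" and hc: "h g \<in> carrier R" if "g \<in> carrier G" for g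
    using f[OF that] h[OF that] additive_subgroup.a_Hcarr[OF homogeneous_subgroup[OF that]] by auto
  have fin: "finite (?F \<union> ?H)" and x: "x = finsum R f ?F" and y: "y = finsum R h ?H"
    using assms(2,3) by (auto simp: homogeneous_decomposition_def)
  have sub: "?K \<subseteq> ?F \<union> ?H" by auto
  \<comment> \<open>The three supports may differ because of cancellation, so all sums are taken over one
    finite set containing them.\<close>
  have "x = finsum R f (?F \<union> ?H)"
    unfolding x by (rule add.finprod_mono_neutral_cong_left) (use fin fc in auto)
  moreover have "y = finsum R h (?F \<union> ?H)"
    unfolding y by (rule add.finprod_mono_neutral_cong_left) (use fin hc in auto)
  ultimately have "x \<oplus>\<^bsub>R\<^esub> y = finsum R (\<lambda>g. f g \<oplus>\<^bsub>R\<^esub> h g) (?F \<union> ?H)"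
    using fc hc by (subst finsum_addf) auto
  also have "\<dots> = finsum R ?k ?K"
    by (rule add.finprod_mono_neutral_cong_right) (use fin sub fc hc in auto)
  finally have "x \<oplus>\<^bsub>R\<^esub> y = finsum R ?k ?K" .
  moreover have "?k \<in> (\<Pi>\<^sub>E g\<in>carrier G. A g)"
    using f h additive_subgroup.a_closed[OF homogeneous_subgroup] by auto
  ultimately show ?thesis
    using finite_subset[OF sub fin] unfolding homogeneous_decomposition_def by blast
qed

lemma homogeneous_component_add:
  assumes "graded_ring G R A" and "x \<in> carrier R" and "y \<in> carrier R" and "g \<in> carrier G"
  shows "homogeneous_component G R A (x \<oplus>\<^bsub>R\<^esub> y) g =
    homogeneous_component G R A x g \<oplus>\<^bsub>R\<^esub> homogeneous_component G R A y g"
proof -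
  interpret graded_ring G R A by fact
  have D: "homogeneous_decomposition G R A z (homogeneous_component G R A z)"
    if "z \<in> carrier R" for z
    unfolding homogeneous_component_def using direct_sum[OF that] by (rule theI')
  have "homogeneous_component G R A (x \<oplus>\<^bsub>R\<^esub> y) =
    (\<lambda>g\<in>carrier G. homogeneous_component G R A x g \<oplus>\<^bsub>R\<^esub> homogeneous_component G R A y g)"
    unfolding homogeneous_component_def[of G R A "x \<oplus>\<^bsub>R\<^esub> y"]
  proof (rule the1_equality)
    show "\<exists>!f. homogeneous_decomposition G R A (x \<oplus>\<^bsub>R\<^esub> y) f"
      using assms(2,3) by (intro direct_sum) simp
  qed (intro homogeneous_decomposition_add assms D)
  then show ?thesis using assms(4) by simp
qed

lemma right_ideal_set_add:
  assumes "right_ideal X R" and "right_ideal Y R"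
  shows "right_ideal (X <+>\<^bsub>R\<^esub> Y) R"
proof -
  interpret X: right_ideal X R by fact
  interpret Y: right_ideal Y R by fact
  show ?thesis
  proof (intro right_ideal.intro right_ideal_axioms.intro)
    show "additive_subgroup (X <+>\<^bsub>R\<^esub> Y) R"
      by (rule X.add_additive_subgroups[OF X.additive_subgroup_axioms Y.additive_subgroup_axioms])
    show "ring R" by (rule X.ring_axioms)
    fix a r assume "a \<in> X <+>\<^bsub>R\<^esub> Y" and r: "r \<in> carrier R"
    then obtain x y where "x \<in> X" "y \<in> Y" and a: "a = x \<oplus>\<^bsub>R\<^esub> y"
      by (auto simp: set_add_def')
    moreover from this have "a \<otimes>\<^bsub>R\<^esub> r = x \<otimes>\<^bsub>R\<^esub> r \<oplus>\<^bsub>R\<^esub> y \<otimes>\<^bsub>R\<^esub> r"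
      using r by (simp add: X.l_distr)
    ultimately show "a \<otimes>\<^bsub>R\<^esub> r \<in> X <+>\<^bsub>R\<^esub> Y"
      using X.I_r_closed[OF _ r, of x] Y.I_r_closed[OF _ r, of y] unfolding set_add_def' by blast
  qed
qed

lemma graded_right_ideal_set_add:
  assumes "graded_ring G R A" and "graded_right_ideal G R A X" and "graded_right_ideal G R A Y"
  shows "graded_right_ideal G R A (X <+>\<^bsub>R\<^esub> Y)"
proof -
  interpret X: right_ideal X R using assms(2) by (simp add: graded_right_ideal_def)
  interpret Y: right_ideal Y R using assms(3) by (simp add: graded_right_ideal_def)
  have "homogeneous_component G R A z g \<in> X <+>\<^bsub>R\<^esub> Y"
    if "z \<in> X <+>\<^bsub>R\<^esub> Y" and g: "g \<in> carrier G" for z g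
  proof -
    from that(1) obtain x y where "x \<in> X" "y \<in> Y" "z = x \<oplus>\<^bsub>R\<^esub> y" by (auto simp: set_add_def')
    moreover from this have "homogeneous_component G R A z g =
        homogeneous_component G R A x g \<oplus>\<^bsub>R\<^esub> homogeneous_component G R A y g"
      using homogeneous_component_add[OF assms(1) _ _ g] by simp
    ultimately show ?thesis
      using assms(2,3) g unfolding graded_right_ideal_def set_add_def' by blast
  qed
  then show ?thesis
    using right_ideal_set_add[OF X.right_ideal_axioms Y.right_ideal_axioms]
    by (simp add: graded_right_ideal_def)
qed

text \<open>A product of right ideals is a set of sums, but containment in an additive subgroup can be
  tested on the generating products; \<open>(X + I) Y \<subseteq> I\<close> is verified this way.\<close>

lemma ideal_prod_subset_iff:
  assumes "additive_subgroup P R"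
  shows "ideal_prod R X Y \<subseteq> P \<longleftrightarrow> (\<forall>x\<in>X. \<forall>y\<in>Y. x \<otimes>\<^bsub>R\<^esub> y \<in> P)"
proof
  show "\<forall>x\<in>X. \<forall>y\<in>Y. x \<otimes>\<^bsub>R\<^esub> y \<in> P" if "ideal_prod R X Y \<subseteq> P"
  proof (intro ballI)
    fix x y assume "x \<in> X" "y \<in> Y"
    then have "x \<otimes>\<^bsub>R\<^esub> y \<in> ideal_prod R X Y" by (rule ideal_prod.prod)
    with that show "x \<otimes>\<^bsub>R\<^esub> y \<in> P" ..
  qed
  assume P: "\<forall>x\<in>X. \<forall>y\<in>Y. x \<otimes>\<^bsub>R\<^esub> y \<in> P"
  have "z \<in> P" if "z \<in> ideal_prod R X Y" for z
    using that by induction (use P additive_subgroup.a_closed[OF assms] in auto)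
  then show "ideal_prod R X Y \<subseteq> P" by blast
qed

lemma graded_almost_prime_imp_prime:
  assumes G: "graded_ring G R A" and colon: "colon R (ideal_prod R I I) I \<subseteq> I"
    and almost: "graded_almost_prime_right_ideal G R A I"
  shows "graded_prime_right_ideal G R A I"
proof -
  from almost have I: "graded_right_ideal G R A I" and ne: "I \<noteq> carrier R"
    and step: "\<And>X Y. \<lbrakk>graded_right_ideal G R A X; graded_right_ideal G R A Y;
      ideal_prod R X Y \<subseteq> I; \<not> ideal_prod R X Y \<subseteq> ideal_prod R I I\<rbrakk> \<Longrightarrow> X \<subseteq> I \<or> Y \<subseteq> I"
    unfolding graded_almost_prime_right_ideal_def by blast+
  interpret I: right_ideal I R using I by (simp add: graded_right_ideal_def)
  have "X \<subseteq> I \<or> Y \<subseteq> I"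
    if X: "graded_right_ideal G R A X" and Y: "graded_right_ideal G R A Y"
      and XY: "ideal_prod R X Y \<subseteq> I" for X Y
  proof -
    interpret X: right_ideal X R using X by (simp add: graded_right_ideal_def)
    interpret Y: right_ideal Y R using Y by (simp add: graded_right_ideal_def)
    let ?S = "X <+>\<^bsub>R\<^esub> I"
    have X_sub: "X \<subseteq> ?S"
    proof
      fix x assume "x \<in> X"
      then have "x \<oplus>\<^bsub>R\<^esub> \<zero>\<^bsub>R\<^esub> \<in> ?S"
        using additive_subgroup.zero_closed[OF I.additive_subgroup_axioms]
        unfolding set_add_def' by blast
      then show "x \<in> ?S" using \<open>x \<in> X\<close> by simp
    qed
    have I_sub: "I \<subseteq> ?S"
    proof
      fix i assume "i \<in> I"
      then have "\<zero>\<^bsub>R\<^esub> \<oplus>\<^bsub>R\<^esub> i \<in> ?S"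
        using additive_subgroup.zero_closed[OF X.additive_subgroup_axioms]
        unfolding set_add_def' by blast
      then show "i \<in> ?S" using \<open>i \<in> I\<close> by simp
    qed
    have "s \<otimes>\<^bsub>R\<^esub> y \<in> I" if "s \<in> ?S" and y: "y \<in> Y" for s y
    proof -
      from that(1) obtain x i where x: "x \<in> X" and i: "i \<in> I" and s: "s = x \<oplus>\<^bsub>R\<^esub> i"
        by (auto simp: set_add_def')
      have "s \<otimes>\<^bsub>R\<^esub> y = x \<otimes>\<^bsub>R\<^esub> y \<oplus>\<^bsub>R\<^esub> i \<otimes>\<^bsub>R\<^esub> y"
        using s x i y by (simp add: I.l_distr)
      moreover have "x \<otimes>\<^bsub>R\<^esub> y \<in> I"
        using XY x y by (simp add: ideal_prod_subset_iff[OF I.additive_subgroup_axioms])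
      moreover have "i \<otimes>\<^bsub>R\<^esub> y \<in> I" using i y by (simp add: I.I_r_closed)
      ultimately show ?thesis
        using additive_subgroup.a_closed[OF I.additive_subgroup_axioms] by simp
    qed
    then have SY: "ideal_prod R ?S Y \<subseteq> I"
      by (simp add: ideal_prod_subset_iff[OF I.additive_subgroup_axioms])
    show ?thesis
    proof (cases "ideal_prod R ?S Y \<subseteq> ideal_prod R I I")
      case True
      then have "i \<otimes>\<^bsub>R\<^esub> y \<in> ideal_prod R I I" if "i \<in> I" "y \<in> Y" for i y
        using ideal_prod.prod[OF subsetD[OF I_sub that(1)] that(2), of R] by (rule subsetD)
      then have "Y \<subseteq> colon R (ideal_prod R I I) I"
        using Y.a_subset by (auto simp: colon_def)
      then show ?thesis using colon by blast
    next
      case False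
      then show ?thesis
        using step[OF graded_right_ideal_set_add[OF G X I] Y SY] X_sub by blast
    qed
  qed
  then show ?thesis using I ne unfolding graded_prime_right_ideal_def by blast
qed

theorem theorem2p7:
  fixes G :: "('g, 'n) monoid_scheme" and R :: "('a, 'm) ring_scheme"
    and A :: "'g \<Rightarrow> 'a set" and I :: "'a set"
  assumes "graded_ring G R A"
    and "graded_right_ideal G R A I"
    and "colon R (ideal_prod R I I) I \<subseteq> I"
  shows "graded_prime_right_ideal G R A I \<longleftrightarrow> graded_almost_prime_right_ideal G R A I"
proof
  show "graded_almost_prime_right_ideal G R A I" if "graded_prime_right_ideal G R A I"
    using that unfolding graded_prime_right_ideal_def graded_almost_prime_right_ideal_def by blast
  show "graded_prime_right_ideal G R A I" if "graded_almost_prime_right_ideal G R A I"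
    using graded_almost_prime_imp_prime[OF assms(1,3) that] .
qed

end
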